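(* Let $\mathscr{H}$ and $\mathscr{H}'$ be separable Hilbert spaces. Let $A\in\mathscr{L}_{1,\infty}(\mathscr{H})$ and $A'\in\mathscr{L}_{1,\infty}(\mathscr{H}')$ have the same non-zero eigenvalues with the same (algebraic) multiplicities. Then $A$ is measurable if and only if $A'$ is measurable. Moreover, in this case their NC integrals agree: $\int\!\!\!\!\!\!-\;A=\int\!\!\!\!\!\!-\;A'$.
   Context: For a compact operator $T$ on a Hilbert space, $\mu_j(T)$ ($j\ge 0$) is the $(j+1)$-th eigenvalue of $|T|=\sqrt{T^*T}$, in non-increasing order counted with multiplicity. $\mathscr{L}_{1,\infty}(\mathscr{H})$ is the ideal of compact operators on $\mathscr{H}$ with $\mu_j(T)=O(j^{-1})$. An eigenvalue sequence of a compact operator $A$ is a sequence $(\lambda_j(A))_{j\ge0}$ converging to $0$ listing its eigenvalues, each repeated according to algebraic multiplicity (completed by $0$'s if needed), with $|\lambda_0(A)|\ge|\lambda_1(A)|\ge\cdots$; it need not be unique. Let $\ell_\infty$ be the $C^*$-algebra of bounded complex sequences $(a_N)_{N\ge1}$ and $\ell_0$ the closed ideal of sequences converging to $0$. An extended limit $\lim_\omega:\ell_\infty\to\mathbb{C}$ is a state on $\ell_\infty$ that vanishes on $\ell_0$. By convention $(\log N)^{-1}=0$ for $N=1$. For $A\in\mathscr{L}_{1,\infty}(\mathscr{H})$, the Dixmier trace is $\operatorname{Tr}_\omega(A)=\lim_\omega\frac{1}{\log N}\sum_{j<N}\lambda_j(A)$ (independent of the choice of eigenvalue sequence). $A$ is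 measurable if $\operatorname{Tr}_\omega(A)$ is independent of the extended limit; this common value is then the NC integral $\int\!\!\!\!\!\!-\;A$. *)

theory Defs
  imports "HOL-Analysis.Analysis" "HOL-Library.Landau_Symbols"
begin

class chilbert_space = banach +
  fixes scaleC :: "complex \<Rightarrow> 'a \<Rightarrow> 'a"  (infixr \<open>*\<^sub>C\<close> 75)
    and cinner :: "'a \<Rightarrow> 'a \<Rightarrow> complex"
  assumes scaleC_add_right: "c *\<^sub>C (x + y) = c *\<^sub>C x + c *\<^sub>C y"
    and scaleC_add_left: "(c + d) *\<^sub>C x = c *\<^sub>C x + d *\<^sub>C x"
    and scaleC_scaleC: "c *\<^sub>C (d *\<^sub>C x) = (c * d) *\<^sub>C x"
    and scaleR_eq_scaleC: "r *\<^sub>R x = complex_of_real r *\<^sub>C x"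
    and cinner_add_left: "cinner (x + y) z = cinner x z + cinner y z"
    and cinner_scaleC_left: "cinner (c *\<^sub>C x) y = c * cinner x y"
    and cinner_commute: "cinner y x = cnj (cinner x y)"
    and cinner_self: "cinner x x = complex_of_real ((norm x)\<^sup>2)"

global_interpretation cvec: vector_space "scaleC :: complex \<Rightarrow> 'a \<Rightarrow> 'a::chilbert_space"
  using scaleR_eq_scaleC[where 'a = 'a and r = 1]
  by unfold_locales (auto simp: scaleC_add_right scaleC_add_left scaleC_scaleC)

abbreviation clinear :: "('a::chilbert_space \<Rightarrow> 'b::chilbert_space) \<Rightarrow> bool" where
  "clinear \<equiv> Vector_Spaces.linear scaleC scaleC"

text \<open>Boundedness follows from relative compactness of the image of the unit ball.\<close>

definition compact_operator :: "('a::chilbert_space \<Rightarrow> 'a) \<Rightarrow> bool" where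
  "compact_operator T \<longleftrightarrow> clinear T \<and> compact (closure (T ` cball 0 1))"

definition eigenvalue :: "('a::chilbert_space \<Rightarrow> 'a) \<Rightarrow> complex \<Rightarrow> bool" where
  "eigenvalue T z \<longleftrightarrow> (\<exists>x. x \<noteq> 0 \<and> T x = z *\<^sub>C x)"

text \<open>For compact \<open>T\<close> and \<open>z \<noteq> 0\<close> the root space below is finite-dimensional, so the convention
  that \<open>dim\<close> is \<open>0\<close> in infinite dimension plays no role there.\<close>

definition root_space :: "('a::chilbert_space \<Rightarrow> 'a) \<Rightarrow> complex \<Rightarrow> 'a set" where
  "root_space T z = (\<Union>n. {x. ((\<lambda>y. T y - z *\<^sub>C y) ^^ n) x = 0})"

definition alg_multiplicity :: "('a::chilbert_space \<Rightarrow> 'a) \<Rightarrow> complex \<Rightarrow> nat" where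
  "alg_multiplicity T z = cvec.dim (root_space T z)"

text \<open>A non-zero \<open>z\<close> that is not an eigenvalue has algebraic multiplicity \<open>0\<close>, hence does not occur
  in the sequence. The value \<open>0\<close> is left unconstrained: it occurs only after all the non-zero
  eigenvalues, either as an eigenvalue or as completion. The sets \<open>{j. l j = z}\<close> are finite by
  convergence to \<open>0\<close>.\<close>

definition eigenvalue_sequence :: "('a::chilbert_space \<Rightarrow> 'a) \<Rightarrow> (nat \<Rightarrow> complex) \<Rightarrow> bool" where
  "eigenvalue_sequence T l \<longleftrightarrow>
     l \<longlonglongrightarrow> 0 \<and> decseq (\<lambda>j. norm (l j)) \<and>
     (\<forall>z. z \<noteq> 0 \<longrightarrow> card {j. l j = z} = alg_multiplicity T z)"

definition adjoint_op :: "('a::chilbert_space \<Rightarrow> 'a) \<Rightarrow> ('a \<Rightarrow> 'a)" where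
  "adjoint_op T = (THE S. \<forall>x y. cinner (T x) y = cinner x (S y))"

text \<open>Boundedness of an everywhere defined positive operator is automatic (Hellinger--Toeplitz).\<close>

definition positive_op :: "('a::chilbert_space \<Rightarrow> 'a) \<Rightarrow> bool" where
  "positive_op P \<longleftrightarrow> clinear P \<and> (\<forall>x. cinner (P x) x \<in> \<real>\<^sub>\<ge>\<^sub>0)"

definition abs_op :: "('a::chilbert_space \<Rightarrow> 'a) \<Rightarrow> ('a \<Rightarrow> 'a)" where
  "abs_op T = (THE P. positive_op P \<and> P \<circ> P = adjoint_op T \<circ> T)"

text \<open>The eigenvalues of \<open>abs_op T\<close> are non-negative, so its eigenvalue sequence is unique;
  algebraic and geometric multiplicities agree because \<open>abs_op T\<close> is self-adjoint.\<close>

definition singular_value :: "('a::chilbert_space \<Rightarrow> 'a) \<Rightarrow> nat \<Rightarrow> real" where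
  "singular_value T = (THE m. eigenvalue_sequence (abs_op T) (\<lambda>j. complex_of_real (m j)))"

definition weak_trace_class :: "('a::chilbert_space \<Rightarrow> 'a) set" where
  "weak_trace_class = {T. compact_operator T \<and> singular_value T \<in> O(\<lambda>j. 1 / real j)}"

text \<open>A sequence indexed by \<open>N \<ge> 1\<close> is represented by \<open>a :: nat \<Rightarrow> complex\<close>, where \<open>a k\<close> is the term
  of index \<open>N = Suc k\<close>. The algebra of bounded sequences is the set of all \<open>a\<close> with \<open>Bseq a\<close>; the
  values of a functional elsewhere are irrelevant. A state is a positive linear functional that
  maps the unit to \<open>1\<close>, i.e. of norm \<open>1\<close>.\<close>

definition state_linf :: "((nat \<Rightarrow> complex) \<Rightarrow> complex) \<Rightarrow> bool" where
  "state_linf w \<longleftrightarrow>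
     (\<forall>a b. Bseq a \<longrightarrow> Bseq b \<longrightarrow> w (\<lambda>k. a k + b k) = w a + w b) \<and>
     (\<forall>c a. Bseq a \<longrightarrow> w (\<lambda>k. c * a k) = c * w a) \<and>
     (\<forall>a. Bseq a \<longrightarrow> (\<forall>k. a k \<in> \<real>\<^sub>\<ge>\<^sub>0) \<longrightarrow> w a \<in> \<real>\<^sub>\<ge>\<^sub>0) \<and>
     w (\<lambda>_. 1) = 1"

definition extended_limit :: "((nat \<Rightarrow> complex) \<Rightarrow> complex) \<Rightarrow> bool" where
  "extended_limit w \<longleftrightarrow> state_linf w \<and> (\<forall>a. a \<longlonglongrightarrow> 0 \<longrightarrow> w a = 0)"

text \<open>The convention \<open>(log 1)\<inverse> = 0\<close> is built in, since \<open>1 / ln 1 = 1 / 0 = 0\<close>.\<close>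

definition log_mean :: "(nat \<Rightarrow> complex) \<Rightarrow> nat \<Rightarrow> complex" where
  "log_mean l N = complex_of_real (1 / ln (real N)) * (\<Sum>j<N. l j)"

text \<open>The common value over all eigenvalue sequences \<open>l\<close>, so that no choice of \<open>l\<close> is involved. It is well
  defined for \<open>A \<in> weak_trace_class\<close> and an extended limit \<open>w\<close>: then \<open>log_mean l\<close> is bounded, and a
  different choice of \<open>l\<close> changes it only by a null sequence.\<close>

definition Dixmier_trace ::
    "((nat \<Rightarrow> complex) \<Rightarrow> complex) \<Rightarrow> ('a::chilbert_space \<Rightarrow> 'a) \<Rightarrow> complex" where
  "Dixmier_trace w A =
     (THE t. \<forall>l. eigenvalue_sequence A l \<longrightarrow> w (\<lambda>k. log_mean l (Suc k)) = t)"

definition Dixmier_measurable :: "('a::chilbert_space \<Rightarrow> 'a) \<Rightarrow> bool" where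
  "Dixmier_measurable A \<longleftrightarrow>
     (\<exists>t. \<forall>w. extended_limit w \<longrightarrow> Dixmier_trace w A = t)"

definition NC_integral :: "('a::chilbert_space \<Rightarrow> 'a) \<Rightarrow> complex" where
  "NC_integral A = (THE t. \<forall>w. extended_limit w \<longrightarrow> Dixmier_trace w A = t)"

end

theory Submission
  imports Defs
begin

text \<open>The Dixmier trace, and with it measurability and the NC integral, sees an operator only through
  its set of eigenvalue sequences. This set is determined by the algebraic multiplicities at all
  \<open>z \<noteq> 0\<close>: eigenvalue sequences are constrained only by how often each \<open>z \<noteq> 0\<close> occurs, besides
  conditions on the sequence alone. Two operators with the same non-zero eigenvalues and the same
  multiplicities there also have the same multiplicity, namely \<open>0\<close>, at every other \<open>z \<noteq> 0\<close>. So they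
  have the same eigenvalue sequences, and for every extended limit the same Dixmier trace.\<close>

text \<open>If \<open>T - z\<close> vanishes only at the origin, then so do all its iterates.\<close>

lemma root_space_non_eigenvalue:
  assumes "\<not> eigenvalue T z"
  shows "root_space T z = {0}"
proof -
  let ?S = "\<lambda>y. T y - z *\<^sub>C y"
  have S: "y = 0" if "?S y = 0" for y
    using that assms unfolding eigenvalue_def by auto
  have "x = 0" if "(?S ^^ n) x = 0" for n x
    using that
  proof (induction n)
    case (Suc n)
    then have "?S ((?S ^^ n) x) = 0"
      by simp
    then show ?case
      by (rule Suc.IH[OF S])
  qed simp
  moreover have "(?S ^^ 0) 0 = 0"
    by simp
  ultimately show ?thesis
    unfolding root_space_def by blast
qed

lemma alg_multiplicity_non_eigenvalue:
  assumes "\<not> eigenvalue T z"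
  shows "alg_multiplicity T z = 0"
proof -
  have "cvec.dim {0 :: 'a} = card ({} :: 'a set)"
    by (rule cvec.dim_unique) (auto simp: cvec.independent_empty)
  then show ?thesis
    using root_space_non_eigenvalue[OF assms] by (simp add: alg_multiplicity_def)
qed

lemma eigenvalue_sequence_eqI:
  assumes "\<And>z. z \<noteq> 0 \<Longrightarrow> eigenvalue A z \<longleftrightarrow> eigenvalue A' z"
    and "\<And>z. z \<noteq> 0 \<Longrightarrow> eigenvalue A z \<Longrightarrow> alg_multiplicity A z = alg_multiplicity A' z"
  shows "eigenvalue_sequence A = eigenvalue_sequence A'"
proof -
  have "alg_multiplicity A z = alg_multiplicity A' z" if "z \<noteq> 0" for z
    using assms[OF that] by (cases "eigenvalue A z") (auto simp: alg_multiplicity_non_eigenvalue)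
  then show ?thesis
    by (auto simp: fun_eq_iff eigenvalue_sequence_def)
qed

theorem proposition2p21:
  fixes A :: "'h::chilbert_space \<Rightarrow> 'h"
    and A' :: "'k::chilbert_space \<Rightarrow> 'k"
  assumes "separable_space (euclidean :: 'h topology)"
    and "separable_space (euclidean :: 'k topology)"
    and "A \<in> weak_trace_class"
    and "A' \<in> weak_trace_class"
    and "\<And>z. z \<noteq> 0 \<Longrightarrow> eigenvalue A z \<longleftrightarrow> eigenvalue A' z"
    and "\<And>z. z \<noteq> 0 \<Longrightarrow> eigenvalue A z \<Longrightarrow> alg_multiplicity A z = alg_multiplicity A' z"
  shows "(Dixmier_measurable A \<longleftrightarrow> Dixmier_measurable A') \<and>
         (Dixmier_measurable A \<longrightarrow> NC_integral A = NC_integral A')"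
proof -
  have "eigenvalue_sequence A = eigenvalue_sequence A'"
    using assms(5,6) by (rule eigenvalue_sequence_eqI)
  then have "Dixmier_trace w A = Dixmier_trace w A'" for w
    by (simp add: Dixmier_trace_def)
  then show ?thesis
    by (simp add: Dixmier_measurable_def NC_integral_def)
qed

end
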